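(* Let $G$ and $H$ be finite simple graphs with nonempty vertex sets. Then $\alpha^o(G\,\square\,H)=\max\{\alpha^o(G),\alpha^o(H)\}$, where $G\,\square\,H$ is the Cartesian product of $G$ and $H$.
   Context: All graphs are simple, with finite and nonempty vertex set; $V(G)$ and $E(G)$ denote the vertex set and edge set of $G$. Circular altitude: a linear ordering of $V(G)$ is a bijection $\mathcal{U}:\{1,2,\ldots,|V(G)|\}\to V(G)$; write $u_i=\mathcal{U}(i)$. A $\mathcal{U}$-monotonic cycle of length $m$ ($m\ge 1$) is a sequence $u_{i_1},u_{i_2},\ldots,u_{i_m}$ of $m$ pairwise distinct vertices of $G$ such that, whenever $m>1$: (i) $i_1<i_2<\cdots<i_m$; (ii) $u_{i_t}$ and $u_{i_{t+1}}$ are adjacent for each $1\le t\le m-1$; (iii) $u_{i_m}$ and $u_{i_1}$ are adjacent. (So a single vertex is a monotonic cycle of length $1$, and an edge gives one of length $2$.) Let $|\mathcal{U}|$ denote the maximum length of a $\mathcal{U}$-monotonic cycle. The circular altitude $\alpha^o(G)$ is the minimum of $|\mathcal{U}|$ over all linear orderings $\mathcal{U}$ of $V(G)$. Cartesian product: $G\,\square\,H$ is the graph with vertex set $V(G)\times V(H)$ in which $(v_1,h_1)$ and $(v_2,h_2)$ are adjacent if and only if either $v_1=v_2$ and $h_1h_2\in E(H)$, or $h_1=h_2$ and $v_1v_2\in E(G)$. *)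

theory Defs
  imports "Graph_Theory.Pair_Digraph"
begin

text \<open>
  A simple graph is a \<open>pair_graph\<close>: a finite, loop-free, symmetric digraph whose arcs are
  pairs of vertices. An edge \<open>uv\<close> is represented by the two arcs \<open>(u, v)\<close> and \<open>(v, u)\<close>.
\<close>

definition linear_ordering :: "'a pair_pre_digraph \<Rightarrow> (nat \<Rightarrow> 'a) \<Rightarrow> bool" where
  "linear_ordering G U \<longleftrightarrow> bij_betw U {1..card (pverts G)} (pverts G)"

text \<open>
  Here \<open>is\<close> is the list of indices of the vertices \<open>xs\<close>. Lists are indexed from 0, so the
  bound \<open>Suc t < length xs\<close> covers all consecutive pairs.
\<close>

definition monotonic_cycle ::
    "'a pair_pre_digraph \<Rightarrow> (nat \<Rightarrow> 'a) \<Rightarrow> 'a list \<Rightarrow> bool" where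
  "monotonic_cycle G U xs \<longleftrightarrow>
    xs \<noteq> [] \<and> distinct xs \<and>
    (\<exists>is. set is \<subseteq> {1..card (pverts G)} \<and> xs = map U is \<and>
      (length xs > 1 \<longrightarrow>
        sorted_wrt (<) is \<and>
        (\<forall>t. Suc t < length xs \<longrightarrow> (xs ! t, xs ! Suc t) \<in> parcs G) \<and>
        (last xs, hd xs) \<in> parcs G))"

definition ordering_length :: "'a pair_pre_digraph \<Rightarrow> (nat \<Rightarrow> 'a) \<Rightarrow> nat" where
  "ordering_length G U = Max {length xs | xs. monotonic_cycle G U xs}"

definition circular_altitude :: "'a pair_pre_digraph \<Rightarrow> nat" where
  "circular_altitude G = Min {ordering_length G U | U. linear_ordering G U}"

definition cartesian_product ::
    "'a pair_pre_digraph \<Rightarrow> 'b pair_pre_digraph \<Rightarrow> ('a \<times> 'b) pair_pre_digraph"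
    (infixr \<open>\<box>\<close> 80) where
  "G \<box> H =
    \<lparr> pverts = pverts G \<times> pverts H,
      parcs = {((v1, h1), (v2, h2)) | v1 h1 v2 h2.
        (v1, h1) \<in> pverts G \<times> pverts H \<and> (v2, h2) \<in> pverts G \<times> pverts H \<and>
        (v1 = v2 \<and> (h1, h2) \<in> parcs H \<or> h1 = h2 \<and> (v1, v2) \<in> parcs G)} \<rparr>"

lemma pair_graph_cartesian_product:
  assumes "pair_graph G" and "pair_graph H"
  shows "pair_graph (G \<box> H)"
proof -
  interpret G: pair_graph G by fact
  interpret H: pair_graph H by fact
  have fin: "finite (pverts (G \<box> H))"
    by (simp add: cartesian_product_def)
  have sub: "parcs (G \<box> H) \<subseteq> pverts (G \<box> H) \<times> pverts (G \<box> H)"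
    by (auto simp: cartesian_product_def)
  have symG: "(u, v) \<in> parcs G \<Longrightarrow> (v, u) \<in> parcs G" for u v
    using G.pair_sym_arcs unfolding symmetric_def by (simp add: symD)
  have symH: "(u, v) \<in> parcs H \<Longrightarrow> (v, u) \<in> parcs H" for u v
    using H.pair_sym_arcs unfolding symmetric_def by (simp add: symD)
  have sym: "sym (parcs (G \<box> H))"
    by (rule symI) (auto simp: cartesian_product_def intro: symG symH)
  show ?thesis
  proof
    show "finite (pverts (G \<box> H))" by (fact fin)
    show "finite (parcs (G \<box> H))"
      using finite_subset[OF sub] fin by blast
    show "symmetric (with_proj (G \<box> H))"
      using sym by (simp add: symmetric_def)
    show "fst e \<in> pverts (G \<box> H)" and "snd e \<in> pverts (G \<box> H)"
      if "e \<in> parcs (G \<box> H)" for e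
      using sub that by auto
    show "fst e \<noteq> snd e" if "e \<in> parcs (G \<box> H)" for e
      using that by (auto simp: cartesian_product_def dest: G.pair_no_loops H.pair_no_loops)
  qed
qed

text \<open>The sets under \<open>Max\<close> and \<open>Min\<close> are finite and nonempty.\<close>

lemma monotonic_cycle_length_le:
  assumes "linear_ordering G U" and "finite (pverts G)" and "monotonic_cycle G U xs"
  shows "length xs \<le> card (pverts G)"
proof -
  obtain js where "set js \<subseteq> {1..card (pverts G)}" and "xs = map U js"
    using assms(3) unfolding monotonic_cycle_def by blast
  then have "set xs \<subseteq> pverts G"
    using image_mono[of "set js" "{1..card (pverts G)}" U]
      bij_betw_imp_surj_on[OF assms(1)[unfolded linear_ordering_def]]
    by (simp del: One_nat_def)
  moreover have "distinct xs"
    using assms(3) by (simp add: monotonic_cycle_def)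
  ultimately show ?thesis
    using card_mono[OF assms(2), of "set xs"] by (simp add: distinct_card)
qed

lemma finite_monotonic_cycle_lengths:
  assumes "linear_ordering G U" and "finite (pverts G)"
  shows "finite {length xs | xs. monotonic_cycle G U xs}"
proof (rule finite_subset)
  show "{length xs | xs. monotonic_cycle G U xs} \<subseteq> {..card (pverts G)}"
    using monotonic_cycle_length_le[OF assms] by auto
qed simp

lemma monotonic_cycle_singleton:
  assumes "linear_ordering G U" and "v \<in> pverts G"
  shows "monotonic_cycle G U [v]"
proof -
  have "v \<in> U ` {1..card (pverts G)}"
    using assms by (simp add: linear_ordering_def bij_betw_imp_surj_on)
  then obtain i where "i \<in> {1..card (pverts G)}" and "U i = v"
    by (elim imageE) simp
  then show ?thesis
    unfolding monotonic_cycle_def by (intro conjI exI[of _ "[i]"]) auto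
qed

lemma ex_linear_ordering:
  assumes "finite (pverts G)"
  shows "\<exists>U. linear_ordering G U"
  using assms ex_bij_betw_nat_finite_1 unfolding linear_ordering_def by blast

lemma finite_ordering_lengths:
  assumes "finite (pverts G)" and "pverts G \<noteq> {}"
  shows "finite {ordering_length G U | U. linear_ordering G U}"
proof (rule finite_subset)
  have "ordering_length G U \<le> card (pverts G)" if U: "linear_ordering G U" for U
  proof -
    obtain v where "v \<in> pverts G"
      using assms(2) by blast
    then have "{length xs | xs. monotonic_cycle G U xs} \<noteq> {}"
      using monotonic_cycle_singleton[OF U] by blast
    then show ?thesis
      using monotonic_cycle_length_le[OF U assms(1)]
        Max_in[OF finite_monotonic_cycle_lengths[OF U assms(1)]]
      unfolding ordering_length_def by auto
  qed
  then show "{ordering_length G U | U. linear_ordering G U} \<subseteq> {..card (pverts G)}"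
    by auto
qed simp

end

theory Submission
  imports Defs "HOL-Library.Infinite_Set"
begin

text \<open>
  The upper bound comes from the lexicographic order on \<open>G \<box> H\<close> built from optimal orderings of
  \<open>G\<close> and \<open>H\<close>. Along an edge that ascends in this order both coordinates increase weakly.
  The closing edge of a monotonic cycle fixes one coordinate, so that coordinate returns to its
  initial value and hence is constant on the whole cycle. The cycle therefore lies in a single
  copy of \<open>G\<close> or of \<open>H\<close>. The lower bound holds because \<open>G\<close> and \<open>H\<close> embed into \<open>G \<box> H\<close>.
\<close>

text \<open>
  Orderings are handled through injective rank functions on the vertices, since only the
  comparison of ranks matters for monotonic cycles.
\<close>

definition rank_cycle :: "'a pair_pre_digraph \<Rightarrow> ('a \<Rightarrow> nat) \<Rightarrow> 'a list \<Rightarrow> bool" where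
  "rank_cycle G f xs \<longleftrightarrow>
    xs \<noteq> [] \<and> set xs \<subseteq> pverts G \<and> sorted_wrt (\<lambda>x y. f x < f y) xs \<and>
    successively (\<lambda>x y. (x, y) \<in> parcs G) xs \<and>
    (1 < length xs \<longrightarrow> (last xs, hd xs) \<in> parcs G)"

text \<open>Serves both directions: embedding a factor into the product, and projecting a cycle of
  the product onto a factor. The conditions on \<open>p\<close> range over the vertices of
  \<open>xs\<close> only, because a projection respects arcs and ranks merely within one copy of a
  factor.\<close>

lemma rank_cycle_map:
  assumes "rank_cycle G f xs"
    and "\<And>x. x \<in> set xs \<Longrightarrow> p x \<in> pverts H"
    and "\<And>x y. x \<in> set xs \<Longrightarrow> y \<in> set xs \<Longrightarrow> (x, y) \<in> parcs G \<Longrightarrow> (p x, p y) \<in> parcs H"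
    and "\<And>x y. x \<in> set xs \<Longrightarrow> y \<in> set xs \<Longrightarrow> f x < f y \<Longrightarrow> g (p x) < g (p y)"
  shows "rank_cycle H g (map p xs)"
proof -
  have xs: "xs \<noteq> []" "sorted_wrt (\<lambda>x y. f x < f y) xs"
    "successively (\<lambda>x y. (x, y) \<in> parcs G) xs"
    "1 < length xs \<Longrightarrow> (last xs, hd xs) \<in> parcs G"
    using assms(1) by (auto simp: rank_cycle_def)
  have "sorted_wrt (\<lambda>x y. g (p x) < g (p y)) xs"
    using xs(2) by (rule sorted_wrt_mono_rel[rotated]) (rule assms(4))
  moreover have "successively (\<lambda>x y. (p x, p y) \<in> parcs H) xs"
    using xs(3) by (rule successively_mono) (rule assms(3))
  moreover have "(p (last xs), p (hd xs)) \<in> parcs H" if "1 < length xs"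
    using assms(3) xs(1) xs(4)[OF that] by simp
  ultimately show ?thesis
    using assms(2) xs(1)
    by (auto simp: rank_cycle_def sorted_wrt_map successively_map last_map hd_map)
qed

section \<open>Circular altitude in terms of ranks\<close>

lemma monotonic_cycle_iff_rank_cycle:
  assumes "linear_ordering G U"
    and f: "\<And>i j. i \<in> {1..card (pverts G)} \<Longrightarrow> j \<in> {1..card (pverts G)} \<Longrightarrow>
      f (U i) < f (U j) \<longleftrightarrow> i < j"
  shows "monotonic_cycle G U xs \<longleftrightarrow> rank_cycle G f xs"
proof -
  have surj: "U ` {1..card (pverts G)} = pverts G"
    using assms(1) by (simp add: linear_ordering_def bij_betw_def)
  show ?thesis
  proof
    assume "monotonic_cycle G U xs"
    then have "xs \<noteq> []" and "\<exists>js. set js \<subseteq> {1..card (pverts G)} \<and> xs = map U js \<and>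
      (1 < length xs \<longrightarrow> sorted_wrt (<) js \<and>
        (\<forall>t. Suc t < length xs \<longrightarrow> (xs ! t, xs ! Suc t) \<in> parcs G) \<and>
        (last xs, hd xs) \<in> parcs G)"
      unfolding monotonic_cycle_def by - (elim conjE, assumption)+
    then obtain js where js: "xs \<noteq> []" "set js \<subseteq> {1..card (pverts G)}" "xs = map U js"
      "1 < length xs \<longrightarrow> sorted_wrt (<) js \<and>
        (\<forall>t. Suc t < length xs \<longrightarrow> (xs ! t, xs ! Suc t) \<in> parcs G) \<and>
        (last xs, hd xs) \<in> parcs G"
      by (elim exE conjE) (rule that)
    have "set xs \<subseteq> pverts G"
      using image_mono[OF js(2), of U] unfolding surj js(3) set_map .
    show "rank_cycle G f xs"
    proof (cases "1 < length xs")
      case True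
      have "sorted_wrt (\<lambda>x y. f x < f y) xs"
        unfolding js(3) sorted_wrt_map
      proof (rule sorted_wrt_mono_rel)
        show "sorted_wrt (<) js" using js(4) True by blast
      qed (use f js(2) in blast)
      then show ?thesis
        using js(1,4) True \<open>set xs \<subseteq> pverts G\<close>
        by (auto simp: rank_cycle_def successively_conv_nth)
    next
      \<comment> \<open>For a single vertex \<open>monotonic_cycle\<close> says nothing about order
        or adjacency, and the conditions of \<open>rank_cycle\<close> hold trivially.\<close>
      case False
      then obtain x where "xs = [x]"
        using js(1) by (cases xs) auto
      then show ?thesis
        using \<open>set xs \<subseteq> pverts G\<close> by (simp add: rank_cycle_def)
    qed
  next
    assume cyc: "rank_cycle G f xs"
    then have "set xs \<subseteq> U ` {1..card (pverts G)}"
      unfolding surj by (simp add: rank_cycle_def)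
    \<comment> \<open>A list over the image of \<open>U\<close> is the image of a list of
      indices.\<close>
    then have "xs \<in> map U ` lists {1..card (pverts G)}"
      unfolding lists_image[symmetric] by (rule in_listsI[OF ballI, OF subsetD])
    then obtain js where js: "set js \<subseteq> {1..card (pverts G)}" "xs = map U js"
      unfolding in_lists_conv_set image_iff by blast
    have xs: "xs \<noteq> []" "sorted_wrt (\<lambda>x y. f x < f y) xs"
      "\<forall>t. Suc t < length xs \<longrightarrow> (xs ! t, xs ! Suc t) \<in> parcs G"
      "1 < length xs \<longrightarrow> (last xs, hd xs) \<in> parcs G"
      using cyc by (simp_all add: rank_cycle_def successively_conv_nth)
    have "sorted_wrt (<) js"
      using xs(2) unfolding js(2) sorted_wrt_map
      by (rule sorted_wrt_mono_rel[rotated]) (use f js(1) in blast)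
    moreover have "distinct xs"
      using xs(2) by (induction xs) auto
    ultimately show "monotonic_cycle G U xs"
      unfolding monotonic_cycle_def
      by (intro conjI exI[of _ js] impI xs(1) js) (use xs(3,4) in blast)+
  qed
qed

lemma ordering_length_le_iff:
  assumes "linear_ordering G U" "finite (pverts G)" "pverts G \<noteq> {}"
  shows "ordering_length G U \<le> k \<longleftrightarrow> (\<forall>xs. monotonic_cycle G U xs \<longrightarrow> length xs \<le> k)"
proof -
  have "{length xs | xs. monotonic_cycle G U xs} \<noteq> {}"
    using monotonic_cycle_singleton[OF assms(1)] assms(3) by blast
  then show ?thesis
    unfolding ordering_length_def
    using Max_le_iff[OF finite_monotonic_cycle_lengths[OF assms(1,2)]] by auto
qed

text \<open>An ordering yields ranks through its inverse, and an injective rank function yields an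
  ordering by listing the vertices by increasing rank. Ranks may be arbitrary naturals, so they can
  be pulled back or combined without renumbering.\<close>

lemma circular_altitude_le_iff:
  assumes fin: "finite (pverts G)" and ne: "pverts G \<noteq> {}"
  shows "circular_altitude G \<le> k \<longleftrightarrow>
    (\<exists>f. inj_on f (pverts G) \<and> (\<forall>xs. rank_cycle G f xs \<longrightarrow> length xs \<le> k))"
proof -
  have "circular_altitude G \<le> k \<longleftrightarrow> (\<exists>U. linear_ordering G U \<and> ordering_length G U \<le> k)"
    unfolding circular_altitude_def
    using Min_le_iff[OF finite_ordering_lengths[OF assms]] ex_linear_ordering[OF fin] by auto
  also have "\<dots> \<longleftrightarrow> (\<exists>U. linear_ordering G U \<and> (\<forall>xs. monotonic_cycle G U xs \<longrightarrow> length xs \<le> k))"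
    using ordering_length_le_iff[OF _ assms] by blast
  also have "\<dots> \<longleftrightarrow>
    (\<exists>f. inj_on f (pverts G) \<and> (\<forall>xs. rank_cycle G f xs \<longrightarrow> length xs \<le> k))"
    (is "?L \<longleftrightarrow> ?R")
  proof
    assume ?L
    then obtain U where U: "linear_ordering G U"
      and le: "\<And>xs. monotonic_cycle G U xs \<Longrightarrow> length xs \<le> k"
      by blast
    let ?f = "inv_into {1..card (pverts G)} U"
    have bij: "bij_betw U {1..card (pverts G)} (pverts G)"
      using U by (simp add: linear_ordering_def)
    have "inj_on ?f (pverts G)"
      using bij_betw_inv_into[OF bij] by (rule bij_betw_imp_inj_on)
    moreover have "monotonic_cycle G U xs \<longleftrightarrow> rank_cycle G ?f xs" for xs
      using U by (rule monotonic_cycle_iff_rank_cycle)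
        (simp add: bij_betw_inv_into_left[OF bij] del: One_nat_def)
    ultimately show ?R
      using le by blast
  next
    assume ?R
    then obtain f where inj: "inj_on f (pverts G)"
      and le: "\<And>xs. rank_cycle G f xs \<Longrightarrow> length xs \<le> k"
      by blast
    let ?n = "card (pverts G)" and ?g = "inv_into (pverts G) f"
    have "finite (f ` pverts G)"
      using fin by simp
    \<comment> \<open>\<open>h'\<close> enumerates the ranks increasingly from index 0;
      \<open>h\<close> shifts this to start at 1, as \<open>linear_ordering\<close> demands.\<close>
    then obtain h' where h': "bij_betw h' {..<card (f ` pverts G)} (f ` pverts G)"
        "strict_mono_on {..<card (f ` pverts G)} h'"
      by (rule ex_bij_betw_strict_mono_card)
    define h where "h = h' \<circ> (\<lambda>i. i - 1)"
    have card: "card (f ` pverts G) = ?n"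
      using inj by (rule card_image)
    have "bij_betw (\<lambda>i. i - 1) {1..?n} {..<?n}"
      by (rule bij_betw_byWitness[where f' = Suc]) auto
    then have h: "bij_betw h {1..?n} (f ` pverts G)"
      using h'(1) unfolding card h_def by (rule bij_betw_trans)
    have mono: "strict_mono_on {1..?n} h"
      using h'(2) unfolding card h_def by (intro strict_mono_onI) (simp add: strict_mono_onD)
    have U: "linear_ordering G (?g \<circ> h)"
      unfolding linear_ordering_def
      using h bij_betw_inv_into[OF inj_on_imp_bij_betw[OF inj]]
      by (intro bij_betw_trans) auto
    have fU: "f ((?g \<circ> h) i) = h i" if "i \<in> {1..?n}" for i
      using bij_betwE[OF h] that by (simp add: f_inv_into_f del: One_nat_def)
    have "monotonic_cycle G (?g \<circ> h) xs \<longleftrightarrow> rank_cycle G f xs" for xs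
      using U
    proof (rule monotonic_cycle_iff_rank_cycle)
      fix i j assume ij: "i \<in> {1..?n}" "j \<in> {1..?n}"
      show "f ((?g \<circ> h) i) < f ((?g \<circ> h) j) \<longleftrightarrow> i < j"
        unfolding fU[OF ij(1)] fU[OF ij(2)] by (rule strict_mono_on_less[OF mono ij])
    qed
    then show ?L
      using U le by blast
  qed
  finally show ?thesis .
qed

section \<open>Monotonicity under embeddings\<close>

text \<open>An optimal rank function of \<open>H\<close> is pulled back along \<open>p\<close>;
  cycles of \<open>G\<close> then map to cycles of \<open>H\<close> of the same length.\<close>

lemma circular_altitude_mono:
  assumes "finite (pverts G)" "pverts G \<noteq> {}" "finite (pverts H)"
    and inj: "inj_on p (pverts G)"
    and verts: "\<And>x. x \<in> pverts G \<Longrightarrow> p x \<in> pverts H"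
    and arcs: "\<And>x y. x \<in> pverts G \<Longrightarrow> y \<in> pverts G \<Longrightarrow> (x, y) \<in> parcs G \<Longrightarrow>
      (p x, p y) \<in> parcs H"
  shows "circular_altitude G \<le> circular_altitude H"
proof -
  have "pverts H \<noteq> {}"
    using assms(2) verts by blast
  then obtain g where g: "inj_on g (pverts H)"
    "\<And>xs. rank_cycle H g xs \<Longrightarrow> length xs \<le> circular_altitude H"
    using circular_altitude_le_iff[OF assms(3), of "circular_altitude H"] by auto
  have "inj_on (g \<circ> p) (pverts G)"
    using inj verts by (intro comp_inj_on inj_on_subset[OF g(1)]) auto
  moreover have "length xs \<le> circular_altitude H" if cyc: "rank_cycle G (g \<circ> p) xs" for xs
  proof -
    have "set xs \<subseteq> pverts G"
      using cyc by (simp add: rank_cycle_def)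
    then have "rank_cycle H g (map p xs)"
      using verts arcs by (intro rank_cycle_map[OF cyc]) (auto simp: subset_iff)
    then show ?thesis
      using g(2) by fastforce
  qed
  ultimately show ?thesis
    using circular_altitude_le_iff[OF assms(1,2)] by blast
qed

section \<open>Cycles in the product\<close>

text \<open>Every value is squeezed between the first and the last, which agree.\<close>

lemma successively_le_constant:
  fixes q :: "'a \<Rightarrow> 'b :: linorder"
  assumes "successively (\<lambda>x y. q x \<le> q y) xs" and "q (last xs) = q (hd xs)" and "x \<in> set xs"
  shows "q x = q (hd xs)"
proof -
  have "sorted (map q xs)"
    using assms(1) by (simp add: successively_map successively_conv_sorted_wrt[symmetric])
  then have "q (hd xs) \<le> q x" "q x \<le> q (last xs)"
    using assms(3) by (induction xs) auto
  then show ?thesis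
    using assms(2) by simp
qed

text \<open>Each arc of the product moves within a single copy of a factor, so \<open>K\<close> is
  compared with \<open>f\<close> and \<open>g\<close> only inside such copies.\<close>

lemma rank_cycle_product_length_le:
  assumes G: "pair_graph G" and H: "pair_graph H"
    and f: "inj_on f (pverts G)" and g: "inj_on g (pverts H)"
    and K1: "\<And>u u' v. K (u, v) < K (u', v) \<Longrightarrow> f u < f u'"
    and K2: "\<And>u v v'. K (u, v) < K (u, v') \<Longrightarrow> g v < g v'"
    and leG: "\<And>xs. rank_cycle G f xs \<Longrightarrow> length xs \<le> a"
    and leH: "\<And>xs. rank_cycle H g xs \<Longrightarrow> length xs \<le> b"
    and cyc: "rank_cycle (G \<box> H) K xs"
  shows "length xs \<le> max a b"
proof -
  interpret G: pair_graph G by (fact G)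
  interpret H: pair_graph H by (fact H)
  have ne: "xs \<noteq> []" and V: "set xs \<subseteq> pverts G \<times> pverts H"
    and sorted: "successively (\<lambda>x y. K x < K y) xs"
    and adj: "successively (\<lambda>x y. (x, y) \<in> parcs (G \<box> H)) xs"
    and closing: "1 < length xs \<Longrightarrow> (last xs, hd xs) \<in> parcs (G \<box> H)"
    using cyc
    by (auto simp: rank_cycle_def cartesian_product_def intro: successively_if_sorted_wrt)
  \<comment> \<open>An arc fixes one coordinate; \<open>K1\<close> or \<open>K2\<close> makes the
    rank of the other increase.\<close>
  have "successively (\<lambda>x y. f (fst x) \<le> f (fst y) \<and> g (snd x) \<le> g (snd y)) xs"
    unfolding successively_conv_nth
  proof (intro allI impI)
    fix t assume t: "Suc t < length xs"
    have "K (xs ! t) < K (xs ! Suc t)" "(xs ! t, xs ! Suc t) \<in> parcs (G \<box> H)"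
      using t sorted adj by (simp_all add: successively_conv_nth)
    then show "f (fst (xs ! t)) \<le> f (fst (xs ! Suc t)) \<and> g (snd (xs ! t)) \<le> g (snd (xs ! Suc t))"
      by (auto simp: cartesian_product_def dest!: K1 K2)
  qed
  then have incr: "successively (\<lambda>x y. f (fst x) \<le> f (fst y)) xs"
      "successively (\<lambda>x y. g (snd x) \<le> g (snd y)) xs"
    by (auto elim: successively_mono)
  have "fst (last xs) = fst (hd xs) \<or> snd (last xs) = snd (hd xs)"
  proof (cases "1 < length xs")
    case True
    then show ?thesis
      using closing by (auto simp: cartesian_product_def)
  next
    case False
    then show ?thesis
      using ne by (cases xs) auto
  qed
  then show ?thesis
  proof
    assume "fst (last xs) = fst (hd xs)"
    then have "f (fst x) = f (fst (hd xs))" if "x \<in> set xs" for x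
      using successively_le_constant[of "f \<circ> fst" xs] incr(1) that by simp
    \<comment> \<open>Injectivity of \<open>f\<close> on the vertices turns equal ranks into equal
      vertices.\<close>
    then have fst: "fst x = fst (hd xs)" if "x \<in> set xs" for x
      using that V ne hd_in_set[OF ne] by (metis f inj_onD mem_Times_iff subsetD)
    have "rank_cycle H g (map snd xs)"
    proof (rule rank_cycle_map[OF cyc])
      fix x assume "x \<in> set xs"
      then show "snd x \<in> pverts H" using V by auto
    next
      fix x y assume xy: "x \<in> set xs" "y \<in> set xs"
      then have eq: "fst x = fst y" using fst by metis
      \<comment> \<open>An arc coming from \<open>G\<close> would be a loop there, as the first
        coordinates agree.\<close>
      show "(snd x, snd y) \<in> parcs H" if "(x, y) \<in> parcs (G \<box> H)"
        using that eq by (auto simp: cartesian_product_def dest: G.pair_no_loops)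
      show "g (snd x) < g (snd y)" if "K x < K y"
        using K2 that eq by (metis prod.collapse)
    qed
    then show ?thesis
      using leH by fastforce
  next
    assume "snd (last xs) = snd (hd xs)"
    then have "g (snd x) = g (snd (hd xs))" if "x \<in> set xs" for x
      using successively_le_constant[of "g \<circ> snd" xs] incr(2) that by simp
    then have snd: "snd x = snd (hd xs)" if "x \<in> set xs" for x
      using that V ne hd_in_set[OF ne] by (metis g inj_onD mem_Times_iff subsetD)
    have "rank_cycle G f (map fst xs)"
    proof (rule rank_cycle_map[OF cyc])
      fix x assume "x \<in> set xs"
      then show "fst x \<in> pverts G" using V by auto
    next
      fix x y assume xy: "x \<in> set xs" "y \<in> set xs"
      then have eq: "snd x = snd y" using snd by metis
      show "(fst x, fst y) \<in> parcs G" if "(x, y) \<in> parcs (G \<box> H)"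
        using that eq by (auto simp: cartesian_product_def dest: H.pair_no_loops)
      show "f (fst x) < f (fst y)" if "K x < K y"
        using K1 that eq by (metis prod.collapse)
    qed
    then show ?thesis
      using leG by fastforce
  qed
qed

theorem theorem3:
  fixes G :: "'a pair_pre_digraph" and H :: "'b pair_pre_digraph"
  assumes "pair_graph G" and "pverts G \<noteq> {}"
    and "pair_graph H" and "pverts H \<noteq> {}"
  shows "circular_altitude (G \<box> H) = max (circular_altitude G) (circular_altitude H)"
proof (rule antisym)
  interpret G: pair_graph G by fact
  interpret H: pair_graph H by fact
  have V: "pverts (G \<box> H) = pverts G \<times> pverts H"
    by (simp add: cartesian_product_def)
  have fin: "finite (pverts (G \<box> H))" and ne: "pverts (G \<box> H) \<noteq> {}"
    using assms(2,4) by (simp_all add: V)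
  show "max (circular_altitude G) (circular_altitude H) \<le> circular_altitude (G \<box> H)"
  proof (rule max.boundedI)
    obtain v where "v \<in> pverts H"
      using assms(4) by blast
    then show "circular_altitude G \<le> circular_altitude (G \<box> H)"
      using assms(2) fin
      \<comment> \<open>\<open>G\<close> is embedded as the copy at a fixed vertex \<open>v\<close>
        of \<open>H\<close>.\<close>
      by (intro circular_altitude_mono[where p = "\<lambda>u. (u, v)"])
        (auto simp: cartesian_product_def inj_on_def)
    obtain u where "u \<in> pverts G"
      using assms(2) by blast
    then show "circular_altitude H \<le> circular_altitude (G \<box> H)"
      using assms(4) fin
      by (intro circular_altitude_mono[where p = "\<lambda>v. (u, v)"])
        (auto simp: cartesian_product_def inj_on_def)
  qed
  obtain f where f: "inj_on f (pverts G)"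
    "\<And>xs. rank_cycle G f xs \<Longrightarrow> length xs \<le> circular_altitude G"
    using circular_altitude_le_iff[of G "circular_altitude G"] assms(2) by auto
  obtain g where g: "inj_on g (pverts H)"
    "\<And>xs. rank_cycle H g xs \<Longrightarrow> length xs \<le> circular_altitude H"
    using circular_altitude_le_iff[of H "circular_altitude H"] assms(4) by auto
  \<comment> \<open>\<open>N\<close> exceeds every rank in \<open>H\<close>, so \<open>K\<close>
    compares the pairs \<open>(f u, g v)\<close> lexicographically on the product, and
    \<open>div\<close> and \<open>mod\<close> by \<open>N\<close> recover both ranks.\<close>
  define N where "N = Suc (Max (g ` pverts H))"
  define K where "K = (\<lambda>(u, v). f u * N + g v)"
  have N: "g v < N" if "v \<in> pverts H" for v
    using that by (simp add: N_def less_Suc_eq_le)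
  have K: "K (u, v) div N = f u" "K (u, v) mod N = g v" if "v \<in> pverts H" for u v
    using N[OF that] by (simp_all add: K_def)
  have "inj_on K (pverts (G \<box> H))"
    unfolding V
  proof (rule inj_onI, clarify)
    fix u v u' v'
    assume mem: "u \<in> pverts G" "v \<in> pverts H" "u' \<in> pverts G" "v' \<in> pverts H"
      and eq: "K (u, v) = K (u', v')"
    have "f u = f u'" "g v = g v'"
      using K[OF mem(2)] K[OF mem(4)] eq by metis+
    then show "u = u' \<and> v = v'"
      using f(1) g(1) mem by (simp add: inj_onD)
  qed
  moreover have "length xs \<le> max (circular_altitude G) (circular_altitude H)"
    if "rank_cycle (G \<box> H) K xs" for xs
    \<comment> \<open>The placeholders stand for \<open>K1\<close> and \<open>K2\<close>: with one
      coordinate fixed, its summand cancels in the comparison of \<open>K\<close>.\<close>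
    using assms(1,3) f(1) g(1) _ _ f(2) g(2) that
    by (rule rank_cycle_product_length_le) (simp_all add: K_def)
  ultimately show "circular_altitude (G \<box> H) \<le> max (circular_altitude G) (circular_altitude H)"
    using circular_altitude_le_iff[OF fin ne] by blast
qed

end
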